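(* Let $A,B,C$ be qubit systems (each $\mathbb{C}^2$ with standard basis $\{|0\rangle,|1\rangle\}$) and let $A',B',C'$ be quantum systems of arbitrary dimensions. Let $\rho_{ABCA'B'C'}$ be a density operator on the joint system. Then $\rho_{ABCA'B'C'}$ is a quantum state for 3-party perfectly secure secret sharing (PSSS) if and only if it is a secret-sharing state, i.e. if and only if there exist a density operator $\rho_{A'B'C'}$ on $A'B'C'$ and unitary operators $U_{ijk}$ on $A'B'C'$, one for each $(i,j,k)\in\{0,1\}^3$ with $i+j+k\equiv 0 \pmod 2$, such that $$\rho_{ABCA'B'C'}=\frac14\sum_{\substack{i+j+k\equiv 0\ (\mathrm{mod}\ 2)\\ i'+j'+k'\equiv 0\ (\mathrm{mod}\ 2)}} |ijk\rangle\langle i'j'k'|_{ABC}\otimes U_{ijk}\,\rho_{A'B'C'}\,U_{i'j'k'}^{\dagger},$$ where the sum runs over all $i,j,k,i',j',k'\in\{0,1\}$ satisfying the two parity conditions.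
   Context: Alice holds systems $AA'$, Bob holds $BB'$, Charlie holds $CC'$. An eavesdropper Eve is assumed to hold the purifying system $E$: let $|\Psi\rangle_{ABCA'B'C'E}$ be a purification of $\rho_{ABCA'B'C'}$. The three participants measure $A,B,C$ in the standard basis. Write $$|\Psi\rangle=\sum_{i,j,k\in\{0,1\}}\sqrt{p_{ijk}}\,|ijk\rangle_{ABC}\,|\Psi_{ijk}\rangle_{A'B'C'E}$$ with unit vectors $|\Psi_{ijk}\rangle$, so that $p_{ijk}$ is the probability that Alice, Bob and Charlie obtain the bits $i,j,k$, and $\rho^E_{ijk}=\mathrm{tr}_{A'B'C'}(|\Psi_{ijk}\rangle\langle\Psi_{ijk}|)$ is Eve's state after outcome $ijk$. The state $\rho_{ABCA'B'C'}$ is a *quantum state for 3-party perfectly secure secret sharing (PSSS)* if both of the following hold: (i) the secret bits are unbiased and perfectly correlated: $p_{000}=p_{011}=p_{101}=p_{110}=1/4$ and $p_{ijk}=0$ for all other $i,j,k$; (ii) Eve obtains no information about the secret bits: $\rho^E_{000}=\rho^E_{011}=\rho^E_{101}=\rho^E_{110}$.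
   Formalization: The systems A', B', C' are taken of arbitrary finite dimension; in infinite dimension the forward direction fails, since vectors with the same reduced state for Eve may be related only by a non-unitary isometry such as a shift. *)

theory Defs
  imports "HOL-Analysis.Analysis" "HOL-Library.Z2"
begin

instance bit :: finite
proof
  have "(UNIV :: bit set) \<subseteq> {0, 1}" by auto
  then show "finite (UNIV :: bit set)" by (rule finite_subset) simp
qed

text \<open>
  A finite type of cardinality n serves as the index type of the standard basis of a system
  with state space \<open>\<complex>\<^sup>n\<close>; a composite system is indexed by a product type.  An operator is a
  square matrix over the index type, \<open>A $ x $ y\<close> being the entry in row x and column y.
\<close>

definition adj :: "complex^'n^'n \<Rightarrow> complex^'n^'n" where
  "adj A = (\<chi> x y. cnj (A $ y $ x))"

definition unitary :: "complex^'n^'n \<Rightarrow> bool" where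
  "unitary U \<longleftrightarrow> adj U ** U = mat 1 \<and> U ** adj U = mat 1"

definition hermitian :: "complex^'n^'n \<Rightarrow> bool" where
  "hermitian A \<longleftrightarrow> adj A = A"

definition positive_semidefinite :: "complex^'n^'n \<Rightarrow> bool" where
  "positive_semidefinite A \<longleftrightarrow>
     hermitian A \<and> (\<forall>v :: complex^'n. 0 \<le> Re (\<Sum>x\<in>UNIV. cnj (v $ x) * (A *v v) $ x))"

definition density_operator :: "complex^'n^'n \<Rightarrow> bool" where
  "density_operator \<rho> \<longleftrightarrow> positive_semidefinite \<rho> \<and> trace \<rho> = 1"

definition tensor_op :: "complex^'m^'m \<Rightarrow> complex^'n^'n \<Rightarrow> complex^('m \<times> 'n)^('m \<times> 'n)" where
  "tensor_op A B = (\<chi> x y. A $ fst x $ fst y * B $ snd x $ snd y)"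

definition ketbra :: "'n \<Rightarrow> 'n \<Rightarrow> complex^'n^'n" where
  "ketbra a b = (\<chi> x y. if x = a \<and> y = b then 1 else 0)"

type_synonym qubits3 = "bit \<times> bit \<times> bit"

text \<open>
  The dimension d of Eve's system varies inside the definition of a PSSS state, so it is a natural
  number rather than a type.  A vector of \<open>\<complex>\<^sup>n \<otimes> \<complex>\<^sup>d\<close> is given by its amplitudes
  \<open>\<Psi> x e\<close>, which vanish for \<open>e \<ge> d\<close>.
\<close>

definition is_purification ::
    "nat \<Rightarrow> ('n::finite \<Rightarrow> nat \<Rightarrow> complex) \<Rightarrow> complex^'n^'n \<Rightarrow> bool" where
  "is_purification d \<Psi> \<rho> \<longleftrightarrow>
     (\<forall>x e. d \<le> e \<longrightarrow> \<Psi> x e = 0) \<and>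
     (\<forall>x y. \<rho> $ x $ y = (\<Sum>e<d. \<Psi> x e * cnj (\<Psi> y e)))"

definition outcome_prob ::
    "nat \<Rightarrow> ('q \<times> 's::finite \<Rightarrow> nat \<Rightarrow> complex) \<Rightarrow> 'q \<Rightarrow> real" where
  "outcome_prob d \<Psi> q = (\<Sum>s\<in>UNIV. \<Sum>e<d. (cmod (\<Psi> (q, s) e))\<^sup>2)"

text \<open>For an outcome of probability 0 the following is the zero vector.\<close>

definition conditional_ket ::
    "nat \<Rightarrow> ('q \<times> 's::finite \<Rightarrow> nat \<Rightarrow> complex) \<Rightarrow> 'q \<Rightarrow> 's \<Rightarrow> nat \<Rightarrow> complex" where
  "conditional_ket d \<Psi> q s e = \<Psi> (q, s) e / complex_of_real (sqrt (outcome_prob d \<Psi> q))"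

definition eve_state ::
    "nat \<Rightarrow> ('q \<times> 's::finite \<Rightarrow> nat \<Rightarrow> complex) \<Rightarrow> 'q \<Rightarrow> nat \<Rightarrow> nat \<Rightarrow> complex" where
  "eve_state d \<Psi> q e e' =
     (\<Sum>s\<in>UNIV. conditional_ket d \<Psi> q s e * cnj (conditional_ket d \<Psi> q s e'))"

lemma outcome_prob_nonneg: "0 \<le> outcome_prob d \<Psi> q"
  unfolding outcome_prob_def by (intro sum_nonneg) auto

lemma ket_expansion:
  assumes "\<And>x e. d \<le> e \<Longrightarrow> \<Psi> x e = 0"
  shows "\<Psi> (q, s) e = complex_of_real (sqrt (outcome_prob d \<Psi> q)) * conditional_ket d \<Psi> q s e"
proof (cases "outcome_prob d \<Psi> q = 0")
  case False
  then show ?thesis by (simp add: conditional_ket_def)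
next
  case True
  have "\<Psi> (q, s) e = 0"
  proof (cases "e < d")
    case False
    then show ?thesis using assms by simp
  next
    case e: True
    have "(\<Sum>e<d. (cmod (\<Psi> (q, s) e))\<^sup>2) = 0"
      using True unfolding outcome_prob_def
      by (subst (asm) sum_nonneg_eq_0_iff) (auto intro!: sum_nonneg)
    then show ?thesis using e by (subst (asm) sum_nonneg_eq_0_iff) auto
  qed
  then show ?thesis using True by simp
qed

lemma conditional_ket_unit:
  assumes "outcome_prob d \<Psi> q \<noteq> 0"
  shows "(\<Sum>s\<in>UNIV. \<Sum>e<d. (cmod (conditional_ket d \<Psi> q s e))\<^sup>2) = 1"
proof -
  have "(\<Sum>s\<in>UNIV. \<Sum>e<d. (cmod (conditional_ket d \<Psi> q s e))\<^sup>2)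
      = outcome_prob d \<Psi> q / outcome_prob d \<Psi> q"
    unfolding conditional_ket_def
    by (simp add: norm_divide power_divide outcome_prob_nonneg flip: sum_divide_distrib)
       (simp add: outcome_prob_def)
  then show ?thesis using assms by simp
qed

text \<open>
  The purification is arbitrary: any two differ by an isometry on Eve's side, and every density
  operator has one, so quantifying existentially would define the same property.
\<close>

definition psss_state ::
    "complex^(qubits3 \<times> 's::finite)^(qubits3 \<times> 's) \<Rightarrow> bool" where
  "psss_state \<rho> \<longleftrightarrow>
     density_operator \<rho> \<and>
     (\<forall>d \<Psi>. is_purification d \<Psi> \<rho> \<longrightarrow>
        (outcome_prob d \<Psi> (0,0,0) = 1/4 \<and> outcome_prob d \<Psi> (0,1,1) = 1/4 \<and>
         outcome_prob d \<Psi> (1,0,1) = 1/4 \<and> outcome_prob d \<Psi> (1,1,0) = 1/4 \<and>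
         (\<forall>q. q \<notin> {(0,0,0), (0,1,1), (1,0,1), (1,1,0)} \<longrightarrow> outcome_prob d \<Psi> q = 0)) \<and>
        (eve_state d \<Psi> (0,0,0) = eve_state d \<Psi> (0,1,1) \<and>
         eve_state d \<Psi> (0,1,1) = eve_state d \<Psi> (1,0,1) \<and>
         eve_state d \<Psi> (1,0,1) = eve_state d \<Psi> (1,1,0)))"

text \<open>Addition on type \<^typ>\<open>bit\<close> is modulo 2.\<close>

definition even_triples :: "qubits3 set" where
  "even_triples = {(i, j, k). i + j + k = 0}"

definition secret_sharing_state ::
    "complex^(qubits3 \<times> 's::finite)^(qubits3 \<times> 's) \<Rightarrow> bool" where
  "secret_sharing_state \<rho> \<longleftrightarrow>
     (\<exists>(\<sigma> :: complex^'s^'s) (U :: qubits3 \<Rightarrow> complex^'s^'s).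
        density_operator \<sigma> \<and>
        (\<forall>q \<in> even_triples. unitary (U q)) \<and>
        \<rho> = (1/4) *\<^sub>R (\<Sum>q\<in>even_triples. \<Sum>q'\<in>even_triples.
               tensor_op (ketbra q q') (U q ** \<sigma> ** adj (U q'))))"

end

theory Submission
  imports Defs
begin

text \<open>
  Write a purification of \<open>\<rho>\<close> as vectors \<open>\<psi> q e\<close> of \<open>A'B'C'\<close>, indexed by the outcome q and the basis
  index e of Eve.  The blocks of \<open>\<rho>\<close> are \<open>\<Sum>e. |\<psi> q e\<rangle>\<langle>\<psi> q' e|\<close>, while Eve's state for q is, up to the
  factor \<open>1 / p\<^sub>q\<close>, the Gram matrix of the family \<open>\<psi> q\<close>.  Families with equal Gram matrices are
  related by a unitary, so any one purification yields the required \<open>U\<^sub>q\<close>.  Conversely, if the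
  blocks are \<open>U\<^sub>q \<sigma> U\<^sub>q\<^sub>'\<^sup>\<dagger> / 4\<close>, then the families \<open>U\<^sub>q\<^sup>\<dagger> \<psi> q\<close> all have the same mutual block
  \<open>\<sigma> / 4\<close>; hence their differences have block 0, so they coincide and have the same Gram matrix.
\<close>

subsection \<open>Inner products\<close>

definition cdot :: "complex^'n \<Rightarrow> complex^'n \<Rightarrow> complex" where
  "cdot v w = (\<Sum>x\<in>UNIV. cnj (v $ x) * w $ x)"

lemma cdot_diff_left: "cdot (u - v) w = cdot u w - cdot v w"
  by (simp add: cdot_def algebra_simps sum_subtractf)

lemma cdot_diff_right: "cdot w (u - v) = cdot w u - cdot w v"
  by (simp add: cdot_def algebra_simps sum_subtractf)

lemma cdot_scale_left: "cdot (c *s u) w = cnj c * cdot u w"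
  by (simp add: cdot_def sum_distrib_left mult.assoc)

lemma cdot_scale_right: "cdot w (c *s u) = c * cdot w u"
  by (simp add: cdot_def sum_distrib_left algebra_simps)

lemma cdot_commute: "cdot v w = cnj (cdot w v)"
  by (simp add: cdot_def mult.commute)

lemma cdot_self: "cdot v v = complex_of_real (\<Sum>x\<in>UNIV. (cmod (v $ x))\<^sup>2)"
  by (simp add: cdot_def complex_norm_square mult.commute del: of_real_power)

lemma cdot_self_eq_0_iff: "cdot v v = 0 \<longleftrightarrow> v = 0"
  unfolding cdot_self of_real_eq_0_iff
  by (subst sum_nonneg_eq_0_iff) (auto simp: vec_eq_iff)

lemma cdot_axis_left: "cdot (axis x 1) w = w $ x"
  unfolding cdot_def axis_def
  by (subst sum.remove[of _ x]) (auto intro!: sum.neutral)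

lemma matrix_vector_axis: "(A *v axis x 1) $ y = A $ y $ x" for A :: "complex^'n^'m"
  unfolding matrix_vector_mult_def axis_def
  by (simp, subst sum.remove[of _ x]) (auto intro!: sum.neutral)

lemma adj_adj [simp]: "adj (adj A) = A"
  by (simp add: adj_def vec_eq_iff)

lemma cdot_adj: "cdot v (A *v w) = cdot (adj A *v v) w"
  unfolding cdot_def matrix_vector_mult_def adj_def
  by (simp add: sum_distrib_left sum_distrib_right)
     (subst sum.swap, simp add: algebra_simps)

lemma unitary_adj: "unitary U \<Longrightarrow> unitary (adj U)"
  by (simp add: unitary_def)

lemma unitary_cdot:
  assumes "unitary U"
  shows "cdot (U *v v) (U *v w) = cdot v w"
proof -
  have "cdot (U *v v) (U *v w) = cdot ((adj U ** U) *v v) w"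
    by (simp only: cdot_adj matrix_vector_mul_assoc)
  then show ?thesis using assms by (simp add: unitary_def)
qed

lemma unitaryI: "adj U ** U = mat 1 \<Longrightarrow> unitary U"
  unfolding unitary_def using matrix_left_right_inverse by blast

lemma adj_mult: "adj (A ** B) = adj B ** adj A"
  by (simp add: adj_def matrix_matrix_mult_def vec_eq_iff mult.commute)

lemma adj_mat_1 [simp]: "adj (mat 1) = mat 1"
  by (simp add: adj_def mat_def vec_eq_iff)

lemma unitary_mult:
  assumes "unitary U" "unitary V"
  shows "unitary (U ** V)"
proof (rule unitaryI)
  have "adj (U ** V) ** (U ** V) = adj V ** (adj U ** U) ** V"
    by (simp only: adj_mult matrix_mul_assoc)
  then show "adj (U ** V) ** (U ** V) = mat 1"
    using assms by (simp add: unitary_def)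
qed

subsection \<open>Unitaries between families with equal Gram matrices\<close>

text \<open>
  For complex scalars, the factor \<open>2 / \<parallel>u - w\<parallel>\<^sup>2\<close> of the usual reflection has to be replaced by
  \<open>1 / \<langle>u - w, u\<rangle>\<close>; this agrees with it if \<open>\<langle>u, w\<rangle>\<close> is real.
\<close>

lemma complex_householder:
  fixes u w :: "complex^'n"
  assumes uw: "cdot u u = cdot w w"
  obtains R where "unitary R" "R *v u = w" "\<And>y. cdot (u - w) y = 0 \<Longrightarrow> R *v y = y"
proof (cases "u = w")
  case True
  then show ?thesis using that[of "mat 1"] by (simp add: unitary_def)
next
  case False
  define x where "x = u - w"
  define z where "z = cdot x u"
  define R :: "complex^'n^'n" where "R = mat 1 - (\<chi> i j. x $ i * cnj (x $ j) / z)"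
  \<comment> \<open>Equal norms of \<open>u\<close> and \<open>w\<close> make the real part of
    \<open>z\<close> half the squared norm of \<open>x\<close>, so \<open>z\<close> is nonzero and
    dividing by it is legitimate.\<close>
  have zz: "z + cnj z = cdot x x"
    unfolding z_def x_def
    by (simp add: cdot_commute[symmetric] cdot_diff_left cdot_diff_right uw)
  have "cdot x x \<noteq> 0" using False by (simp add: cdot_self_eq_0_iff x_def)
  then have z0: "z \<noteq> 0" using zz by auto
  have R: "R *v y = y - (cdot x y / z) *s x" for y
    unfolding R_def matrix_vector_mult_diff_rdistrib matrix_vector_mul_lid
    by (simp add: vec_eq_iff matrix_vector_mult_def cdot_def sum_distrib_left sum_distrib_right
        sum_divide_distrib algebra_simps)
  have adjR: "adj R *v y = y - (cdot x y / cnj z) *s x" for y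
  proof -
    have "adj R = mat 1 - (\<chi> i j. x $ i * cnj (x $ j) / cnj z)"
      by (simp add: R_def adj_def vec_eq_iff mat_def mult.commute)
    then show ?thesis
      by (simp only: matrix_vector_mult_diff_rdistrib matrix_vector_mul_lid)
         (simp add: vec_eq_iff matrix_vector_mult_def cdot_def
          sum_distrib_left sum_distrib_right sum_divide_distrib algebra_simps)
  qed
  have "adj R *v (R *v y) = y" for y
  proof -
    define a where "a = cdot x y / z"
    define b where "b = cdot x (R *v y) / cnj z"
    have Ry: "R *v y = y - a *s x" by (simp add: R a_def)
    have "cdot x y = a * z" using z0 by (simp add: a_def)
    \<comment> \<open>By \<open>zz\<close> the left side is \<open>a * z - a * (z + cnj z)\<close>.
      Hence \<open>adj R\<close> adds back exactly the multiple of \<open>x\<close> that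
      \<open>R\<close> removed.\<close>
    then have "cdot x (R *v y) = - a * cnj z"
      unfolding Ry cdot_diff_right cdot_scale_right zz[symmetric] by (simp add: algebra_simps)
    then have "b = - a" using z0 by (simp add: b_def)
    moreover have "adj R *v (R *v y) = (y - a *s x) - b *s x"
      unfolding adjR b_def[symmetric] by (simp only: Ry)
    ultimately show ?thesis by (simp add: vec_eq_iff)
  qed
  then have "adj R ** R = mat 1"
    by (simp add: matrix_eq flip: matrix_vector_mul_assoc)
  then have "unitary R" by (rule unitaryI)
  moreover have "R *v u = w"
    using z0 by (simp add: R flip: z_def) (simp add: x_def)
  moreover have "R *v y = y" if "cdot (u - w) y = 0" for y
    using that by (simp add: R flip: x_def)
  ultimately show ?thesis using that by blast
qed

lemma unitary_mat_1: "unitary (mat 1)"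
  by (simp add: unitary_def)

text \<open>The Gram condition makes \<open>U *v v d - w d\<close> orthogonal to every earlier
  \<open>w e\<close>, so \<open>R\<close> fixes these vectors. Thus \<open>R ** U\<close> keeps what
  \<open>U\<close> achieved and also moves \<open>v d\<close> to \<open>w d\<close>.\<close>

lemma extend_unitary_by_reflection:
  fixes v w :: "nat \<Rightarrow> complex^'n"
  assumes gram: "\<And>e f. e < Suc d \<Longrightarrow> f < Suc d \<Longrightarrow> cdot (v e) (v f) = cdot (w e) (w f)"
    and U: "unitary U" "\<And>e. e < d \<Longrightarrow> U *v v e = w e"
    and R: "unitary R" "R *v (U *v v d) = w d"
      "\<And>y. cdot (U *v v d - w d) y = 0 \<Longrightarrow> R *v y = y"
  shows "\<exists>V. unitary V \<and> (\<forall>e<Suc d. V *v v e = w e)"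
proof -
  have "cdot (U *v v d) (w e) = cdot (w d) (w e)" if "e < d" for e
    by (simp only: U(2)[OF that, symmetric] unitary_cdot[OF U(1)] gram lessI less_SucI that)
  then have "R *v w e = w e" if "e < d" for e
    using that by (intro R(3)) (simp add: cdot_diff_left)
  then have "\<forall>e<Suc d. (R ** U) *v v e = w e"
    by (simp add: All_less_Suc R(2) U(2) flip: matrix_vector_mul_assoc)
  then show ?thesis using unitary_mult[OF R(1) U(1)] by blast
qed

lemma extend_equal_gram_unitary:
  fixes v w :: "nat \<Rightarrow> complex^'n"
  assumes gram: "\<And>e f. e < Suc d \<Longrightarrow> f < Suc d \<Longrightarrow> cdot (v e) (v f) = cdot (w e) (w f)"
    and U: "unitary U" "\<forall>e<d. U *v v e = w e"
  shows "\<exists>V. unitary V \<and> (\<forall>e<Suc d. V *v v e = w e)"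
proof -
  have "cdot (U *v v d) (U *v v d) = cdot (w d) (w d)"
    by (simp add: unitary_cdot[OF U(1)] gram)
  then show ?thesis
    by (rule complex_householder) (rule extend_unitary_by_reflection[OF gram U(1)], simp_all add: U(2))
qed

lemma equal_gram_unitary:
  fixes v w :: "nat \<Rightarrow> complex^'n"
  assumes "\<And>e f. e < d \<Longrightarrow> f < d \<Longrightarrow> cdot (v e) (v f) = cdot (w e) (w f)"
  shows "\<exists>U. unitary U \<and> (\<forall>e<d. U *v v e = w e)"
  using assms
  \<comment> \<open>One reflection is composed per vector. \<open>meta_mp\<close> supplies the Gram
    premise of the induction hypothesis, which is the given one restricted to smaller
    indices.\<close>
  by (induction d)
     (blast intro: unitary_mat_1,
      rule exE[OF meta_mp], assumption, simp add: less_SucI,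
      elim conjE, rule extend_equal_gram_unitary)

subsection \<open>Existence of purifications\<close>

lemma positive_semidefinite_cdot:
  "positive_semidefinite A \<longleftrightarrow> adj A = A \<and> (\<forall>v. 0 \<le> Re (cdot v (A *v v)))"
  by (simp add: positive_semidefinite_def hermitian_def cdot_def)

lemma hermitian_entry: "adj A = A \<Longrightarrow> cnj (A $ y $ x) = A $ x $ y"
  by (metis (no_types, lifting) adj_def vec_lambda_beta)

lemma cdot_matrix_axis: "adj A = A \<Longrightarrow> cdot v (A *v axis x 1) = cnj ((A *v v) $ x)"
  by (metis cdot_adj cdot_axis_left cdot_commute)

text \<open>Serves two choices of \<open>t\<close>: a free multiple of an entry, when the diagonal
  entry at \<open>x\<close> is 0, and the value that completes the square, when it is not.\<close>

lemma cdot_shift_axis: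
  assumes "adj A = A"
  shows "cdot (v - t *s axis x 1) (A *v (v - t *s axis x 1)) =
    cdot v (A *v v) - t * cnj ((A *v v) $ x) - cnj t * (A *v v) $ x + t * cnj t * A $ x $ x"
  by (simp add: matrix_vector_mult_diff_distrib vector_scalar_commute cdot_diff_left cdot_diff_right
      cdot_scale_left cdot_scale_right cdot_axis_left cdot_matrix_axis[OF assms, of v] matrix_vector_axis
      algebra_simps)

lemma positive_semidefinite_diagonal:
  assumes "positive_semidefinite A"
  shows "A $ x $ x = complex_of_real (Re (A $ x $ x))" "0 \<le> Re (A $ x $ x)"
proof -
  have "cnj (A $ x $ x) = A $ x $ x"
    using assms hermitian_entry positive_semidefinite_cdot by metis
  then show "A $ x $ x = complex_of_real (Re (A $ x $ x))"
    by (simp add: complex_eq_iff)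
  show "0 \<le> Re (A $ x $ x)"
    using assms unfolding positive_semidefinite_cdot
    by (metis cdot_axis_left matrix_vector_axis)
qed

text \<open>A vanishing diagonal entry kills the term quadratic in \<open>r\<close>. The form is
  then affine in \<open>r\<close>, and stays nonnegative only if its slope is 0.\<close>

lemma cdot_shift_zero_diagonal:
  assumes "adj A = A" "A $ x $ x = 0"
  shows "cdot (axis y 1 - (complex_of_real r * A $ x $ y) *s axis x 1)
      (A *v (axis y 1 - (complex_of_real r * A $ x $ y) *s axis x 1)) =
    A $ y $ y - complex_of_real (2 * r * (cmod (A $ x $ y))\<^sup>2)"
  unfolding cdot_shift_axis[OF assms(1)]
  by (simp add: assms(2) cdot_axis_left matrix_vector_axis complex_norm_square algebra_simps
      del: of_real_power)

lemma affine_nonneg_imp_slope_zero: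
  fixes b c :: real
  assumes "\<And>r. 0 \<le> b - r * c"
  shows "c = 0"
proof (rule ccontr)
  assume "c \<noteq> 0"
  then have "(b + 1) / c * c = b + 1" by simp
  \<comment> \<open>At this argument the affine function takes the value -1.\<close>
  then show False using assms[of "(b + 1) / c"] by simp
qed

lemma positive_semidefinite_zero_diagonal:
  assumes psd: "positive_semidefinite A" and x: "A $ x $ x = 0"
  shows "A $ x $ y = 0"
proof -
  have "adj A = A" using psd by (simp add: positive_semidefinite_cdot)
  note shift = cdot_shift_zero_diagonal[OF this x, symmetric]
  \<comment> \<open>Taking \<open>r / 2\<close> absorbs the factor 2, so the slope is the squared
    modulus itself.\<close>
  have "0 \<le> Re (A $ y $ y - complex_of_real (2 * (r / 2) * (cmod (A $ x $ y))\<^sup>2))" for r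
    using psd unfolding positive_semidefinite_cdot shift by blast
  then have "(cmod (A $ x $ y))\<^sup>2 = 0"
    by (intro affine_nonneg_imp_slope_zero[of "Re (A $ y $ y)"]) simp
  then show ?thesis by simp
qed

text \<open>For hermitian \<open>A\<close> with nonzero pivot this is the usual Schur complement of
  the entry at \<open>x\<close>, padded with a zero row and column so that the index type stays the
  same.\<close>

definition schur_complement :: "'n \<Rightarrow> complex^'n^'n \<Rightarrow> complex^'n^'n" where
  "schur_complement x A = (\<chi> y z. A $ y $ z - A $ y $ x * cnj (A $ z $ x) / A $ x $ x)"

lemma schur_complement_mult:
  assumes "adj A = A"
  shows "schur_complement x A *v v = A *v v - ((A *v v) $ x / A $ x $ x) *s (A *v axis x 1)"
  by (simp add: vec_eq_iff matrix_vector_axis)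
     (simp add: schur_complement_def matrix_vector_mult_def hermitian_entry[OF assms]
       sum_distrib_left sum_distrib_right sum_divide_distrib algebra_simps sum_subtractf)

text \<open>Completing the square: the shift along \<open>axis x 1\<close> is the one that minimises
  the form of a positive semidefinite \<open>A\<close>, and the complement has that minimum as its
  form. It therefore inherits positivity.\<close>

lemma cdot_schur_complement:
  assumes herm: "adj A = A" and nz: "A $ x $ x \<noteq> 0"
  shows "cdot v (schur_complement x A *v v) =
    cdot (v - ((A *v v) $ x / A $ x $ x) *s axis x 1) (A *v (v - ((A *v v) $ x / A $ x $ x) *s axis x 1))"
proof -
  \<comment> \<open>For this shift the last two terms of \<open>cdot_shift_axis\<close>
    cancel.\<close>
  have "c / A $ x $ x * b * A $ x $ x = b * c" for b c
    using nz by simp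
  then show ?thesis
    unfolding schur_complement_mult[OF herm] cdot_shift_axis[OF herm] cdot_diff_right cdot_scale_right
      cdot_matrix_axis[OF herm]
    by (simp only: diff_add_cancel)
qed

lemma adj_schur_complement:
  assumes "adj A = A"
  shows "adj (schur_complement x A) = schur_complement x A"
  unfolding adj_def schur_complement_def
  by (simp add: vec_eq_iff hermitian_entry[OF assms] mult.commute)

lemma positive_semidefinite_schur_complement:
  "positive_semidefinite A \<Longrightarrow> A $ x $ x \<noteq> 0 \<Longrightarrow> positive_semidefinite (schur_complement x A)"
  by (simp add: positive_semidefinite_cdot cdot_schur_complement adj_schur_complement)

text \<open>A rank-one summand costs Eve one extra dimension, whose component is
  \<open>u\<close>.\<close>

lemma purification_Suc:
  assumes "is_purification d \<Psi> B"
    and A: "\<And>y z. A $ y $ z = B $ y $ z + u y * cnj (u z)"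
  shows "is_purification (Suc d) (\<lambda>y e. if e = d then u y else \<Psi> y e) A"
  using assms(1) unfolding is_purification_def A sum.lessThan_Suc
  by (intro conjI allI impI) (auto dest: Suc_le_lessD)

lemma purification_extend_schur_complement:
  assumes psd: "positive_semidefinite A" and "A $ x $ x \<noteq> 0"
    and "is_purification d \<Psi> (schur_complement x A)"
  shows "\<exists>d \<Psi>. is_purification d \<Psi> A"
proof -
  have "complex_of_real (sqrt (Re (A $ x $ x))) * complex_of_real (sqrt (Re (A $ x $ x))) = A $ x $ x"
    using positive_semidefinite_diagonal[OF psd, of x] by (simp flip: of_real_mult)
  then show ?thesis
    by (intro exI)
       \<comment> \<open>The Cholesky column: its rank-one matrix is exactly what the Schur
         complement subtracts.\<close>
       (rule purification_Suc[OF assms(3), where u = "\<lambda>y. A $ y $ x / complex_of_real (sqrt (Re (A $ x $ x)))"],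
        simp add: schur_complement_def)
qed

text \<open>Elimination clears row \<open>x\<close> and cannot fill a row that was zero before, so
  \<open>x\<close> leaves the support.\<close>

lemma schur_complement_supported:
  assumes "adj A = A" "A $ x $ x \<noteq> 0"
    and "\<And>y z. y \<notin> insert x S \<Longrightarrow> A $ y $ z = 0" "y \<notin> S"
  shows "schur_complement x A $ y $ z = 0"
  using assms(2-4) hermitian_entry[OF assms(1), of z x]
  by (cases "y = x") (simp_all add: schur_complement_def)

lemma zero_diagonal_supported:
  assumes "positive_semidefinite A" "A $ x $ x = 0"
    and "\<And>y z. y \<notin> insert x S \<Longrightarrow> A $ y $ z = 0" "y \<notin> S"
  shows "A $ y $ z = 0"
  using positive_semidefinite_zero_diagonal[OF assms(1,2)] assms(3)[of y] assms(4) by blast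

lemma purification_exists_step:
  fixes A :: "complex^'n::finite^'n"
  assumes IH: "\<And>B :: complex^'n^'n. positive_semidefinite B \<Longrightarrow>
      (\<And>y z. y \<notin> S \<Longrightarrow> B $ y $ z = 0) \<Longrightarrow> \<exists>d \<Psi>. is_purification d \<Psi> B"
    and psd: "positive_semidefinite A"
    and supp: "\<And>y z. y \<notin> insert x S \<Longrightarrow> A $ y $ z = 0"
    and nz: "A $ x $ x \<noteq> 0"
  shows "\<exists>d \<Psi>. is_purification d \<Psi> A"
proof -
  have "adj A = A" using psd by (simp add: positive_semidefinite_cdot)
  then have "\<exists>d \<Psi>. is_purification d \<Psi> (schur_complement x A)"
    by (intro IH positive_semidefinite_schur_complement[OF psd nz])
       (rule schur_complement_supported[OF _ nz supp])
  then show ?thesis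
    by (elim exE) (rule purification_extend_schur_complement[OF psd nz])
qed

text \<open>Cholesky elimination, one basis vector at a time.\<close>

lemma purification_exists_supported:
  fixes A :: "complex^'n::finite^'n"
  assumes "finite S" "positive_semidefinite A" "\<And>x y. x \<notin> S \<Longrightarrow> A $ x $ y = 0"
  shows "\<exists>d \<Psi>. is_purification d \<Psi> A"
proof -
  from assms show ?thesis
  proof (induction S arbitrary: A rule: finite_induct)
    case empty
    then show ?case
      by (intro exI[of _ 0] exI[of _ "\<lambda>_ _. 0"]) (simp add: is_purification_def)
  next
    case (insert x S)
    show ?case
      \<comment> \<open>With a zero pivot, row \<open>x\<close> already vanishes and the induction
        hypothesis applies to \<open>A\<close> itself. Otherwise one elimination step is
        made.\<close>
      by (cases "A $ x $ x = 0")
         (rule insert.IH[OF insert.prems(1)],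
          rule zero_diagonal_supported[OF insert.prems(1) _ insert.prems(2)], assumption+,
          rule purification_exists_step[OF insert.IH insert.prems])
  qed
qed

lemma purification_exists:
  fixes A :: "complex^'n::finite^'n"
  assumes "positive_semidefinite A"
  obtains d \<Psi> where "is_purification d \<Psi> A"
  using purification_exists_supported[of UNIV A] assms by auto

subsection \<open>Secret sharing\<close>

lemma even_triples_eq: "even_triples = {(0,0,0), (0,1,1), (1,0,1), (1,1,0)}"
  unfolding even_triples_def
proof (intro set_eqI)
  fix q :: qubits3
  obtain i j k where "q = (i, j, k)" by (cases q)
  then show "q \<in> {(i, j, k). i + j + k = 0} \<longleftrightarrow> q \<in> {(0,0,0), (0,1,1), (1,0,1), (1,1,0)}"
    by (cases i; cases j; cases k) simp_all
qed

lemma all_equal_on_even_triples_iff: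
  "(f (0,0,0) = f (0,1,1) \<and> f (0,1,1) = f (1,0,1) \<and> f (1,0,1) = f (1,1,0)) \<longleftrightarrow>
     (\<forall>q\<in>even_triples. \<forall>q'\<in>even_triples. f q = f q')"
  unfolding even_triples_eq by auto

lemma all_eq_if_iff:
  "(\<forall>x. f x = (if x \<in> A then c else d)) \<longleftrightarrow> (\<forall>x\<in>A. f x = c) \<and> (\<forall>x. x \<notin> A \<longrightarrow> f x = d)"
  by auto

lemma probabilities_iff:
  "(p (0,0,0) = (1/4::real) \<and> p (0,1,1) = 1/4 \<and> p (1,0,1) = 1/4 \<and> p (1,1,0) = 1/4 \<and>
      (\<forall>q. q \<notin> {(0,0,0), (0,1,1), (1,0,1), (1,1,0)} \<longrightarrow> p q = 0)) \<longleftrightarrow>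
     (\<forall>q. p q = (if q \<in> even_triples then 1/4 else 0))"
  by (simp only: all_eq_if_iff even_triples_eq ball_simps simp_thms conj_assoc)

text \<open>Replaces the four listed outcomes by quantification over \<open>even_triples\<close>, so
  that later arguments treat all outcomes alike.\<close>

lemma psss_state_iff:
  "psss_state \<rho> \<longleftrightarrow> density_operator \<rho> \<and>
     (\<forall>d \<Psi>. is_purification d \<Psi> \<rho> \<longrightarrow>
        (\<forall>q. outcome_prob d \<Psi> q = (if q \<in> even_triples then 1/4 else 0)) \<and>
        (\<forall>q\<in>even_triples. \<forall>q'\<in>even_triples. eve_state d \<Psi> q = eve_state d \<Psi> q'))"
  unfolding psss_state_def probabilities_iff[of "outcome_prob d \<Psi>" for d \<Psi>]
    all_equal_on_even_triples_iff[of "eve_state d \<Psi>" for d \<Psi>] ..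

lemma sum_even_triples_entry:
  fixes M :: "qubits3 \<Rightarrow> qubits3 \<Rightarrow> complex^'s::finite^'s"
  shows "((1/4) *\<^sub>R (\<Sum>q\<in>even_triples. \<Sum>q'\<in>even_triples. tensor_op (ketbra q q') (M q q')))
      $ (r, s) $ (r', s') =
    (if r \<in> even_triples \<and> r' \<in> even_triples then M r r' $ s $ s' / 4 else 0)"
proof -
  have fin: "finite even_triples" by (simp add: even_triples_eq)
  have "(\<Sum>q\<in>even_triples. \<Sum>q'\<in>even_triples. tensor_op (ketbra q q') (M q q')) $ (r, s) $ (r', s') =
      (\<Sum>q\<in>even_triples. \<Sum>q'\<in>even_triples.
         if q = r then if q' = r' then M r r' $ s $ s' else 0 else 0)"
    unfolding sum_component
    by (intro sum.cong refl) (auto simp: tensor_op_def ketbra_def)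
  also have "\<dots> = (\<Sum>q\<in>even_triples. if q = r then
       \<Sum>q'\<in>even_triples. if q' = r' then M r r' $ s $ s' else 0 else 0)"
    by (intro sum.cong refl) auto
  also have "\<dots> = (if r \<in> even_triples \<and> r' \<in> even_triples then M r r' $ s $ s' else 0)"
    using fin by simp
  finally show ?thesis by (simp add: scaleR_conv_of_real[where 'a=complex])
qed

section \<open>Blocks as partial traces over Eve's system\<close>

definition block :: "nat \<Rightarrow> (nat \<Rightarrow> complex^'s) \<Rightarrow> (nat \<Rightarrow> complex^'s) \<Rightarrow> complex^'s^'s" where
  "block d v w = (\<chi> s s'. \<Sum>e<d. v e $ s * cnj (w e $ s'))"

lemma sum_rotate:
  "(\<Sum>x\<in>A. \<Sum>y\<in>B. \<Sum>z\<in>C. f x y z) = (\<Sum>z\<in>C. \<Sum>x\<in>A. \<Sum>y\<in>B. f x y z)"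
proof -
  have "(\<Sum>x\<in>A. \<Sum>y\<in>B. \<Sum>z\<in>C. f x y z) = (\<Sum>x\<in>A. \<Sum>z\<in>C. \<Sum>y\<in>B. f x y z)"
    by (intro sum.cong refl sum.swap)
  then show ?thesis by (simp add: sum.swap[of _ C A])
qed

lemma block_conjugate:
  "U ** block d v w ** adj V = block d (\<lambda>e. U *v v e) (\<lambda>e. V *v w e)"
proof -
  have "(U ** block d v w ** adj V) $ s $ s' = block d (\<lambda>e. U *v v e) (\<lambda>e. V *v w e) $ s $ s'" for s s'
  proof -
    have "(U ** block d v w ** adj V) $ s $ s' =
       (\<Sum>k\<in>UNIV. \<Sum>l\<in>UNIV. \<Sum>e<d. cnj (V $ s' $ k * w e $ k) * (U $ s $ l * v e $ l))"
      by (simp add: matrix_matrix_mult_def block_def adj_def sum_distrib_left sum_distrib_right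
          algebra_simps)
    also have "\<dots> = (\<Sum>e<d. cnj ((V *v w e) $ s') * (U *v v e) $ s)"
      by (subst sum_rotate) (simp only: matrix_vector_mult_def vec_lambda_beta cnj_sum sum_product)
    also have "\<dots> = block d (\<lambda>e. U *v v e) (\<lambda>e. V *v w e) $ s $ s'"
      by (simp add: block_def mult.commute)
    finally show ?thesis .
  qed
  then show ?thesis by (simp add: vec_eq_iff)
qed

lemma block_diff:
  "(\<Sum>e<d. complex_of_real ((cmod (v e $ s - w e $ s))\<^sup>2)) =
    block d v v $ s $ s - block d v w $ s $ s - block d w v $ s $ s + block d w w $ s $ s"
  by (simp add: block_def complex_norm_square algebra_simps sum_subtractf sum.distrib
      del: of_real_power)

text \<open>The diagonal entry of the block of \<open>v - w\<close> is B - B - B + B = 0, and it is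
  a sum of squared moduli.\<close>

lemma blocks_eq_imp_entry_eq:
  assumes "block d v v = B" "block d v w = B" "block d w v = B" "block d w w = B" "e < d"
  shows "v e $ s = w e $ s"
proof -
  have "complex_of_real (\<Sum>e<d. (cmod (v e $ s - w e $ s))\<^sup>2) = 0"
    unfolding of_real_sum block_diff assms by simp
  then have "\<forall>e\<in>{..<d}. (cmod (v e $ s - w e $ s))\<^sup>2 = 0"
    unfolding of_real_eq_0_iff by (subst (asm) sum_nonneg_eq_0_iff) simp_all
  then show ?thesis using \<open>e < d\<close> by simp
qed

lemma blocks_eq_imp_eq:
  assumes "block d v v = B" "block d v w = B" "block d w v = B" "block d w w = B" "e < d"
  shows "v e = w e"
  unfolding vec_eq_iff using blocks_eq_imp_entry_eq[OF assms] by blast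

text \<open>The unnormalised counterpart of \<open>conditional_ket\<close>, as a vector of the
  participants' systems for each basis index of Eve.\<close>

definition slice :: "('q \<times> 's::finite \<Rightarrow> nat \<Rightarrow> complex) \<Rightarrow> 'q \<Rightarrow> nat \<Rightarrow> complex^'s" where
  "slice \<Psi> q e = (\<chi> s. \<Psi> (q, s) e)"

lemma purification_entry:
  assumes "is_purification d \<Psi> \<rho>"
  shows "\<rho> $ (q, s) $ (q', s') = block d (slice \<Psi> q) (slice \<Psi> q') $ s $ s'"
  using assms by (simp add: is_purification_def block_def slice_def)

lemma outcome_prob_trace:
  "complex_of_real (outcome_prob d \<Psi> q) = trace (block d (slice \<Psi> q) (slice \<Psi> q))"
  by (simp add: outcome_prob_def trace_def block_def slice_def complex_norm_square del: of_real_power)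

text \<open>Tracing out the participants leaves inner products of slices, with the indices
  transposed. For probability 0 both sides are 0, since division by 0 yields 0.\<close>

lemma eve_state_gram:
  "eve_state d \<Psi> q e e' = cdot (slice \<Psi> q e') (slice \<Psi> q e) / outcome_prob d \<Psi> q"
proof -
  have "complex_of_real (sqrt p) * complex_of_real (sqrt p) = complex_of_real p" if "0 \<le> p" for p
    using that by (simp flip: of_real_mult)
  then show ?thesis
    using outcome_prob_nonneg[of d \<Psi> q]
    by (simp add: eve_state_def conditional_ket_def cdot_def slice_def sum_divide_distrib mult.commute)
qed

lemma cdot_block:
  "cdot u (block d v v *v u) = (\<Sum>e<d. complex_of_real ((cmod (cdot u (v e)))\<^sup>2))"
proof -
  have "cdot u (block d v v *v u) =
      (\<Sum>x\<in>UNIV. \<Sum>y\<in>UNIV. \<Sum>e<d. (cnj (u $ x) * v e $ x) * cnj (cnj (u $ y) * v e $ y))"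
    by (simp add: cdot_def matrix_vector_mult_def block_def sum_distrib_left sum_distrib_right
        algebra_simps)
  also have "\<dots> = (\<Sum>e<d. cdot u (v e) * cnj (cdot u (v e)))"
    by (subst sum_rotate) (simp only: cdot_def cnj_sum sum_product)
  finally show ?thesis by (simp only: complex_norm_square)
qed

lemma adj_block: "adj (block d v w) = block d w v"
  by (simp add: adj_def block_def vec_eq_iff mult.commute)

lemma block_positive_semidefinite: "positive_semidefinite (block d v v)"
  by (simp add: positive_semidefinite_cdot adj_block cdot_block sum_nonneg del: of_real_power)

lemma positive_semidefinite_scale:
  assumes "positive_semidefinite A" "0 \<le> c"
  shows "positive_semidefinite (c *\<^sub>R A)"
proof -
  have "(c *\<^sub>R A) *v v = complex_of_real c *s (A *v v)" for v
    by (simp add: vec_eq_iff matrix_vector_mult_def sum_distrib_left scaleR_conv_of_real[where 'a=complex] mult.assoc)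
  moreover have "adj (c *\<^sub>R A) = c *\<^sub>R adj A"
    by (simp add: adj_def vec_eq_iff)
  ultimately show ?thesis
    using assms by (simp add: positive_semidefinite_cdot cdot_scale_right)
qed

lemma trace_unitary_conjugate:
  assumes "unitary U"
  shows "trace (U ** A ** adj U) = trace A"
  using assms
  by (subst trace_mul_sym) (simp add: unitary_def matrix_mul_assoc)

lemma purification_eq_0: "is_purification d \<Psi> \<rho> \<Longrightarrow> d \<le> e \<Longrightarrow> \<Psi> x e = 0"
  unfolding is_purification_def by blast

definition sharing_operator ::
    "complex^'s^'s \<Rightarrow> (qubits3 \<Rightarrow> complex^'s^'s) \<Rightarrow> complex^(qubits3 \<times> 's::finite)^(qubits3 \<times> 's)" where
  "sharing_operator \<sigma> U = (1/4) *\<^sub>R (\<Sum>q\<in>even_triples. \<Sum>q'\<in>even_triples.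
     tensor_op (ketbra q q') (U q ** \<sigma> ** adj (U q')))"

lemma slice_eq_0:
  assumes "is_purification d \<Psi> \<rho>" "outcome_prob d \<Psi> q = 0"
  shows "slice \<Psi> q e = 0"
  by (simp add: slice_def vec_eq_iff assms(2)
      ket_expansion[of d \<Psi> q, OF purification_eq_0[OF assms(1)]])

lemma slice_eq_0_beyond: "is_purification d \<Psi> \<rho> \<Longrightarrow> d \<le> e \<Longrightarrow> slice \<Psi> q e = 0"
  by (simp add: slice_def vec_eq_iff purification_eq_0)

lemma trace_scaleR: "trace (c *\<^sub>R A) = complex_of_real c * trace A" for A :: "complex^'n^'n"
  by (simp add: trace_def sum_distrib_left scaleR_conv_of_real[where 'a=complex])

text \<open>The block has trace 1/4, the outcome probability, so the factor 4 normalises it.\<close>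

lemma density_operator_slice_block:
  assumes "outcome_prob d \<Psi> q = 1/4"
  shows "density_operator (4 *\<^sub>R block d (slice \<Psi> q) (slice \<Psi> q))"
  by (simp add: assms density_operator_def trace_scaleR positive_semidefinite_scale
      block_positive_semidefinite flip: outcome_prob_trace)

section \<open>From PSSS states to secret-sharing states\<close>

lemma psss_outcome_prob:
  "psss_state \<rho> \<Longrightarrow> is_purification d \<Psi> \<rho> \<Longrightarrow>
    outcome_prob d \<Psi> q = (if q \<in> even_triples then 1/4 else 0)"
  unfolding psss_state_iff by blast

lemma psss_eve_state:
  "psss_state \<rho> \<Longrightarrow> is_purification d \<Psi> \<rho> \<Longrightarrow> q \<in> even_triples \<Longrightarrow> q' \<in> even_triples \<Longrightarrow>
    eve_state d \<Psi> q = eve_state d \<Psi> q'"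
  unfolding psss_state_iff by blast

lemma psss_equal_gram:
  assumes "psss_state \<rho>" "is_purification d \<Psi> \<rho>" "q \<in> even_triples" "q' \<in> even_triples"
  shows "cdot (slice \<Psi> q e) (slice \<Psi> q f) = cdot (slice \<Psi> q' e) (slice \<Psi> q' f)"
  \<comment> \<open>The order \<open>f\<close>, \<open>e\<close> undoes the transposition in
    \<open>eve_state_gram\<close>; the common probability 1/4 then cancels.\<close>
  using fun_cong[OF fun_cong[OF psss_eve_state[OF assms], of f], of e]
  by (simp add: eve_state_gram psss_outcome_prob[OF assms(1,2)] assms(3,4))

lemma sharing_operator_entry:
  "sharing_operator \<sigma> U $ (q, s) $ (q', s') =
    (if q \<in> even_triples \<and> q' \<in> even_triples then (U q ** \<sigma> ** adj (U q')) $ s $ s' / 4 else 0)"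
  unfolding sharing_operator_def by (rule sum_even_triples_entry)

text \<open>By \<open>block_conjugate\<close> the unitaries carry the block of \<open>v\<close> to
  blocks of \<open>w\<close>; the factor 4 cancels the prefactor 1/4, and blocks with an odd label
  are 0 on both sides.\<close>

lemma sharing_operator_block_entry:
  assumes "\<And>q e. q \<in> even_triples \<Longrightarrow> e < d \<Longrightarrow> U q *v v e = w q e"
    and "\<And>q e. q \<notin> even_triples \<Longrightarrow> w q e = 0"
  shows "sharing_operator (4 *\<^sub>R block d v v) U $ (q, s) $ (q', s') = block d (w q) (w q') $ s $ s'"
proof -
  have "U q ** (4 *\<^sub>R block d v v) ** adj (U q') =
      4 *\<^sub>R block d (\<lambda>e. U q *v v e) (\<lambda>e. U q' *v v e)"
    by (simp add: matrix_scalar_ac block_conjugate flip: scalar_matrix_assoc)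
  then show ?thesis
    by (auto simp: assms sharing_operator_entry block_def scaleR_conv_of_real[where 'a=complex])
qed

lemma matrix_pair_eqI:
  assumes "\<And>q s q' s'. A $ (q, s) $ (q', s') = B $ (q, s) $ (q', s')"
  shows "A = B"
proof -
  have "A $ x $ y = B $ x $ y" for x y
    using assms[of "fst x" "snd x" "fst y" "snd y"] by simp
  then show ?thesis unfolding vec_eq_iff by blast
qed

lemma sharing_operator_purification:
  assumes "is_purification d \<Psi> \<rho>"
    and "\<And>q e. q \<in> even_triples \<Longrightarrow> e < d \<Longrightarrow> U q *v v e = slice \<Psi> q e"
    and "\<And>q e. q \<notin> even_triples \<Longrightarrow> slice \<Psi> q e = 0"
  shows "\<rho> = sharing_operator (4 *\<^sub>R block d v v) U"
proof (rule matrix_pair_eqI)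
  show "\<rho> $ (q, s) $ (q', s') = sharing_operator (4 *\<^sub>R block d v v) U $ (q, s) $ (q', s')" for q s q' s'
    unfolding purification_entry[OF assms(1)]
    by (rule sharing_operator_block_entry[symmetric]) (simp_all add: assms(2,3))
qed

lemma secret_sharing_state_iff:
  "secret_sharing_state \<rho> \<longleftrightarrow> (\<exists>\<sigma> U. density_operator \<sigma> \<and>
     (\<forall>q\<in>even_triples. unitary (U q)) \<and> \<rho> = sharing_operator \<sigma> U)"
  unfolding secret_sharing_state_def sharing_operator_def ..

lemma psss_unitaries:
  assumes "psss_state \<rho>" "is_purification d \<Psi> \<rho>" "p \<in> even_triples"
  shows "\<exists>U. \<forall>q\<in>even_triples. unitary (U q) \<and> (\<forall>e<d. U q *v slice \<Psi> p e = slice \<Psi> q e)"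
  by (intro bchoice ballI equal_gram_unitary psss_equal_gram[OF assms])

lemma origin_even: "(0,0,0) \<in> even_triples"
  by (simp add: even_triples_eq)

lemma psss_unitaries_imp_secret_sharing:
  assumes "psss_state \<rho>" "is_purification d \<Psi> \<rho>"
    and U: "\<forall>q\<in>even_triples. unitary (U q) \<and> (\<forall>e<d. U q *v slice \<Psi> (0,0,0) e = slice \<Psi> q e)"
  shows "secret_sharing_state \<rho>"
proof -
  \<comment> \<open>The shared state is the participants' conditional state after outcome 000, which
    serves as the reference.\<close>
  have "density_operator (4 *\<^sub>R block d (slice \<Psi> (0,0,0)) (slice \<Psi> (0,0,0)))"
    by (rule density_operator_slice_block) (simp add: psss_outcome_prob[OF assms(1,2)] origin_even)
  moreover have "\<rho> = sharing_operator (4 *\<^sub>R block d (slice \<Psi> (0,0,0)) (slice \<Psi> (0,0,0))) U"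
    by (rule sharing_operator_purification[OF assms(2)])
       (simp_all add: U slice_eq_0[OF assms(2)] psss_outcome_prob[OF assms(1,2)])
  ultimately show ?thesis
    unfolding secret_sharing_state_iff using U by blast
qed

lemma psss_purification_imp_secret_sharing:
  "psss_state \<rho> \<Longrightarrow> is_purification d \<Psi> \<rho> \<Longrightarrow> secret_sharing_state \<rho>"
  using psss_unitaries[OF _ _ origin_even] psss_unitaries_imp_secret_sharing by blast

lemma psss_imp_positive_semidefinite: "psss_state \<rho> \<Longrightarrow> positive_semidefinite \<rho>"
  unfolding psss_state_def density_operator_def by (elim conjE)

lemma psss_imp_secret_sharing:
  assumes "psss_state \<rho>"
  shows "secret_sharing_state \<rho>"
  by (rule purification_exists[OF psss_imp_positive_semidefinite[OF assms]])
     (rule psss_purification_imp_secret_sharing[OF assms])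

section \<open>From secret-sharing states to PSSS states\<close>

lemma sharing_operator_slice_block:
  assumes "is_purification d \<Psi> (sharing_operator \<sigma> U)"
  shows "block d (slice \<Psi> q) (slice \<Psi> q') =
    (if q \<in> even_triples \<and> q' \<in> even_triples then (1/4) *\<^sub>R (U q ** \<sigma> ** adj (U q')) else 0)"
  by (cases "q \<in> even_triples \<and> q' \<in> even_triples")
     (auto simp: vec_eq_iff sharing_operator_entry scaleR_conv_of_real[where 'a=complex]
       simp flip: purification_entry[OF assms])

text \<open>Conjugation by a unitary preserves the trace, so each even diagonal block has trace 1/4
  and each odd one is 0.\<close>

lemma sharing_operator_outcome_prob:
  assumes "is_purification d \<Psi> (sharing_operator \<sigma> U)" "trace \<sigma> = 1"
    and "\<And>q. q \<in> even_triples \<Longrightarrow> unitary (U q)"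
  shows "outcome_prob d \<Psi> q = (if q \<in> even_triples then 1/4 else 0)"
proof -
  have "complex_of_real (outcome_prob d \<Psi> q) = complex_of_real (if q \<in> even_triples then 1/4 else 0)"
    unfolding outcome_prob_trace sharing_operator_slice_block[OF assms(1)]
    by (simp add: trace_scaleR trace_unitary_conjugate assms(2,3)) (simp add: trace_def)
  then show ?thesis by (simp only: of_real_eq_iff)
qed

lemma sharing_operator_rotated_block:
  assumes "is_purification d \<Psi> (sharing_operator \<sigma> U)"
    and "q \<in> even_triples" "q' \<in> even_triples" "unitary (U q)" "unitary (U q')"
  shows "block d (\<lambda>e. adj (U q) *v slice \<Psi> q e) (\<lambda>e. adj (U q') *v slice \<Psi> q' e) = (1/4) *\<^sub>R \<sigma>"
proof -
  have "adj (U q) ** block d (slice \<Psi> q) (slice \<Psi> q') ** U q' =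
      (1/4) *\<^sub>R ((adj (U q) ** U q) ** \<sigma> ** (adj (U q') ** U q'))"
    using assms(2,3)
    by (simp add: sharing_operator_slice_block[OF assms(1)] matrix_mul_assoc matrix_scalar_ac
        flip: scalar_matrix_assoc)
  then show ?thesis
    \<comment> \<open>The second matrix is itself an adjoint, so that its adjoint is
      \<open>U q'\<close>.\<close>
    using assms(4,5) block_conjugate[of "adj (U q)" d _ _ "adj (U q')"] by (simp add: unitary_def)
qed

lemma sharing_operator_rotated_slice:
  assumes "is_purification d \<Psi> (sharing_operator \<sigma> U)"
    and "q \<in> even_triples" "q' \<in> even_triples" "unitary (U q)" "unitary (U q')"
  shows "adj (U q) *v slice \<Psi> q e = adj (U q') *v slice \<Psi> q' e"
proof -
  \<comment> \<open>The four choices of \<open>p\<close> and \<open>r\<close> are the four block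
    equations that \<open>blocks_eq_imp_eq\<close> asks for.\<close>
  have "block d (\<lambda>e. adj (U p) *v slice \<Psi> p e) (\<lambda>e. adj (U r) *v slice \<Psi> r e) = (1/4) *\<^sub>R \<sigma>"
    if "p \<in> {q, q'}" "r \<in> {q, q'}" for p r
    using that assms(2-5) by (auto intro!: sharing_operator_rotated_block[OF assms(1)])
  then have "e < d \<Longrightarrow> adj (U q) *v slice \<Psi> q e = adj (U q') *v slice \<Psi> q' e"
    by (intro blocks_eq_imp_eq[where B = "(1/4) *\<^sub>R \<sigma>"]) simp_all
  \<comment> \<open>Blocks only see indices below \<open>d\<close>; beyond them all slices are
    0.\<close>
  moreover have "d \<le> e \<Longrightarrow> adj (U q) *v slice \<Psi> q e = adj (U q') *v slice \<Psi> q' e"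
    by (simp add: slice_eq_0_beyond[OF assms(1)])
  ultimately show ?thesis using le_less_linear by blast
qed

lemma sharing_operator_equal_gram:
  assumes "is_purification d \<Psi> (sharing_operator \<sigma> U)"
    and "q \<in> even_triples" "q' \<in> even_triples" "unitary (U q)" "unitary (U q')"
  shows "cdot (slice \<Psi> q e) (slice \<Psi> q f) = cdot (slice \<Psi> q' e) (slice \<Psi> q' f)"
  using sharing_operator_rotated_slice[OF assms]
    unitary_cdot[OF unitary_adj[OF assms(4)], of "slice \<Psi> q e" "slice \<Psi> q f"]
    unitary_cdot[OF unitary_adj[OF assms(5)], of "slice \<Psi> q' e" "slice \<Psi> q' f"]
  by simp

lemma sharing_operator_eve_state:
  assumes "is_purification d \<Psi> (sharing_operator \<sigma> U)" "trace \<sigma> = 1"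
    and "\<And>q. q \<in> even_triples \<Longrightarrow> unitary (U q)" "q \<in> even_triples" "q' \<in> even_triples"
  shows "eve_state d \<Psi> q = eve_state d \<Psi> q'"
  by (intro ext)
     (simp add: eve_state_gram sharing_operator_outcome_prob[OF assms(1,2,3)] assms(4,5)
       sharing_operator_equal_gram[OF assms(1,4,5) assms(3)[OF assms(4)] assms(3)[OF assms(5)]])

text \<open>The PSSS conditions range over all purifications; the probability and Eve-state lemmas
  hold for an arbitrary one.\<close>

lemma sharing_operator_psss:
  assumes "density_operator (sharing_operator \<sigma> U)" "trace \<sigma> = 1"
    and "\<And>q. q \<in> even_triples \<Longrightarrow> unitary (U q)"
  shows "psss_state (sharing_operator \<sigma> U)"
  unfolding psss_state_iff
  by (intro conjI allI impI ballI assms sharing_operator_outcome_prob[where \<sigma> = \<sigma> and U = U]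
      sharing_operator_eve_state[where \<sigma> = \<sigma> and U = U])

lemma secret_sharing_imp_psss:
  "density_operator \<rho> \<Longrightarrow> secret_sharing_state \<rho> \<Longrightarrow> psss_state \<rho>"
  unfolding secret_sharing_state_iff
  by (elim exE conjE) (simp add: sharing_operator_psss density_operator_def)

theorem theorem1:
  fixes \<rho> :: "complex^(qubits3 \<times> ('a::finite \<times> 'b::finite \<times> 'c::finite))^(qubits3 \<times> ('a \<times> 'b \<times> 'c))"
  assumes "density_operator \<rho>"
  shows "psss_state \<rho> \<longleftrightarrow> secret_sharing_state \<rho>"
  by (rule iffI[OF psss_imp_secret_sharing secret_sharing_imp_psss[OF assms]])

end
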